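(* If $X$ is a locally connected compact metric space, then there is no expansive homeomorphism $T\colon X\to X$ such that $(X,T)$ is a CAM $\mathbb{Z}$-system.
   Context: A $\mathbb{Z}$-system $(X,T)$ is a compact metric space $X$ with a homeomorphism $T$. It is expansive if there is $c>0$ such that for all $x\neq y$ there exists $n\in\mathbb{Z}$ with $d(T^nx,T^ny)>c$. It is topologically transitive if for all nonempty open $U,V$ there is $n$ with $T^nU\cap V\neq\emptyset$; the action is faithful if $T^n=\mathrm{id}$ only for $n=0$. A point is periodic if its orbit is finite. The system is chaotic almost minimal (CAM) if: (1) it is topologically transitive and the action is faithful; (2) the periodic points are dense in $X$; (3) every proper closed $T$-invariant subset of $X$ is finite. *)

theory Defs
  imports "HOL-Analysis.Analysis"
begin

text \<open>A Z-system is a compact set X in a metric space together with a homeomorphism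
  T of X onto itself. The integer iterates T^n are given by iterating T (n >= 0)
  or its inverse on X (n < 0).\<close>

definition zit :: "'a set \<Rightarrow> ('a \<Rightarrow> 'a) \<Rightarrow> int \<Rightarrow> 'a \<Rightarrow> 'a" where
  "zit X T n = (if 0 \<le> n then T ^^ nat n else (inv_into X T) ^^ nat (- n))"

definition expansive :: "'a::metric_space set \<Rightarrow> ('a \<Rightarrow> 'a) \<Rightarrow> bool" where
  "expansive X T \<longleftrightarrow> (\<exists>c>0. \<forall>x\<in>X. \<forall>y\<in>X. x \<noteq> y \<longrightarrow>
      (\<exists>n::int. dist (zit X T n x) (zit X T n y) > c))"

definition top_transitive :: "'a::topological_space set \<Rightarrow> ('a \<Rightarrow> 'a) \<Rightarrow> bool" where
  "top_transitive X T \<longleftrightarrow> (\<forall>U V. openin (top_of_set X) U \<and> openin (top_of_set X) V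
      \<and> U \<noteq> {} \<and> V \<noteq> {} \<longrightarrow> (\<exists>n::int. zit X T n ` U \<inter> V \<noteq> {}))"

definition faithful :: "'a set \<Rightarrow> ('a \<Rightarrow> 'a) \<Rightarrow> bool" where
  "faithful X T \<longleftrightarrow> (\<forall>n::int. (\<forall>x\<in>X. zit X T n x = x) \<longrightarrow> n = 0)"

definition periodic_point :: "'a set \<Rightarrow> ('a \<Rightarrow> 'a) \<Rightarrow> 'a \<Rightarrow> bool" where
  "periodic_point X T x \<longleftrightarrow> x \<in> X \<and> finite (range (\<lambda>n::int. zit X T n x))"

definition CAM :: "'a::topological_space set \<Rightarrow> ('a \<Rightarrow> 'a) \<Rightarrow> bool" where
  "CAM X T \<longleftrightarrow>
     top_transitive X T \<and> faithful X T
   \<and> X \<subseteq> closure {x. periodic_point X T x}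
   \<and> (\<forall>Y. closedin (top_of_set X) Y \<and> Y \<noteq> X \<and> T ` Y = Y \<longrightarrow> finite Y)"

end

theory Submission
  imports Defs
begin

text \<open>
  Let \<open>c\<close> be an expansivity constant and \<open>P\<close> a periodic orbit. A small nondegenerate continuum
  expands, forwards or backwards, to diameter more than \<open>c\<close>; at the first such time
  all recent past images have diameter at most \<open>c\<close>. Such a continuum contains two separated
  subcontinua of a definite size staying away from \<open>P\<close>, and uniform expansivity, together with the small
  past images, forces each of them to expand to diameter more than \<open>c\<close> again within a bounded time \<open>N\<close>. As
  \<open>P\<close> is invariant, the subcontinua stay in a compact set \<open>W\<close> disjoint from \<open>P\<close> meanwhile.
  Iterating yields a binary tree of points whose forward orbits remain in \<open>W\<close>.

  The maximal invariant subset \<open>F\<close> of \<open>W\<close> is a proper closed invariant set, hence finite, and orbits that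
  have been in \<open>W\<close> for long shadow points of \<open>F\<close>. Two points from different branches cannot shadow
  the same point of \<open>F\<close>, since they would violate expansivity. So a grown continuum
  shadows more and more points of \<open>F\<close>, which is impossible.

  Faithfulness makes \<open>X\<close> infinite, and local connectedness at an accumulation point provides the
  small nondegenerate continua.
\<close>

section \<open>Iterates, compactness and subcontinua\<close>

lemma homeomorphism_funpow:
  assumes "homeomorphism X X f g"
  shows "homeomorphism X X (f ^^ n) (g ^^ n)"
proof (induction n)
  case 0
  then show ?case by (simp add: homeomorphism_def)
next
  case (Suc n)
  have "homeomorphism X X (f \<circ> f ^^ n) (g ^^ n \<circ> g)"
    using homeomorphism_compose[OF Suc assms] .
  then show ?case by (simp only: funpow.simps(2)[of n f] funpow_Suc_right[of n g])
qed

lemma funpow_image_eq: "f ` A = A \<Longrightarrow> (f ^^ n) ` A = A"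
proof (induction n)
  case (Suc n)
  then show ?case by (simp only: funpow.simps(2) image_comp[symmetric])
qed simp

text \<open>The maximum of the indices in a finite subcover is the bound. This is the source of
  every uniform time bound below: for expansivity, for leaving \<open>W\<close>, and for orbits
  trapped in \<open>W\<close>.\<close>

lemma compact_uniform_index:
  fixes U :: "nat \<Rightarrow> 'a::topological_space set"
  assumes "compact K" "\<And>i. openin (top_of_set K) (U i)" "\<And>x. x \<in> K \<Longrightarrow> \<exists>i. x \<in> U i"
  shows "\<exists>N. \<forall>x\<in>K. \<exists>i\<le>N. x \<in> U i"
proof -
  have "\<exists>V. \<forall>i. open (V i) \<and> U i = K \<inter> V i"
    using assms(2) by (intro choice) (auto simp: openin_open)
  then obtain V where V: "\<And>i. open (V i)" "\<And>i. U i = K \<inter> V i" by blast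
  have "K \<subseteq> (\<Union>i\<in>UNIV. V i)" using assms(3) V(2) by blast
  then obtain I where "finite I" "K \<subseteq> (\<Union>i\<in>I. V i)"
    by (rule compactE_image[OF assms(1) V(1)])
  then have "\<exists>i\<le>Max I. x \<in> U i" if "x \<in> K" for x
    using that V(2) by (metis IntI Max_ge UN_E subsetD)
  then show ?thesis by blast
qed

text \<open>Boundary bumping: the component of \<open>u\<close> in
  \<open>K \<inter> cball u r\<close>, a proper closed subset of the continuum \<open>K\<close>,
  must meet the frontier of that subset relative to \<open>K\<close>. Points of \<open>K\<close>
  closer than \<open>r\<close> to \<open>u\<close> are relatively interior, so the frontier point
  found lies at distance at least \<open>r\<close>.\<close>

lemma subcontinuum_reaching_sphere:
  fixes K :: "'a::metric_space set"
  assumes "compact K" "connected K" "u \<in> K" "y \<in> K" "r < dist u y" "0 < r"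
  obtains E where "compact E" "connected E" "u \<in> E" "E \<subseteq> K \<inter> cball u r" "\<exists>v\<in>E. r \<le> dist u v"
proof -
  define A where "A = K \<inter> cball u r"
  define E where "E = connected_component_of_set (subtopology (top_of_set K) A) u"
  have uA: "u \<in> A" using assms by (simp add: A_def)
  have sub: "subtopology (top_of_set K) A = top_of_set A"
  proof -
    have "K \<inter> A = A" by (auto simp: A_def)
    then show ?thesis by (simp only: subtopology_subtopology)
  qed
  have clA: "closedin (top_of_set K) A" by (simp add: A_def closedin_closed_Int)
  have "compact A" using assms(1) clA closedin_compact by blast
  have E: "E \<in> connected_components_of (subtopology (top_of_set K) A)"
    using uA by (simp add: E_def sub connected_component_in_connected_components_of)
  have "y \<notin> A" using assms by (simp add: A_def)
  then have "A \<noteq> topspace (top_of_set K)" using assms(4) by auto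
  moreover have "connected_space (top_of_set K)"
    using assms(2) by (simp add: connectedin_def flip: connectedin_iff_connected)
  ultimately have "E \<inter> (top_of_set K) frontier_of A \<noteq> {}"
    using assms(1) clA E
    by (intro boundary_bumping_theorem_closed)
      (auto simp: compact_space_subtopology Hausdorff_space_subtopology)
  then obtain v where v: "v \<in> E" "v \<in> (top_of_set K) frontier_of A" by blast
  have "closedin (top_of_set A) E" using E closedin_connected_components_of sub by metis
  then have "compact E" "E \<subseteq> A" using \<open>compact A\<close> closedin_compact closedin_imp_subset by blast+
  moreover have "connected E"
    using connectedin_connected_components_of[OF E] by (simp add: sub connectedin_subtopology)
  moreover have "u \<in> E" using uA by (simp add: E_def sub connected_component_of_refl)
  moreover have "r \<le> dist u v"
  proof (rule ccontr)
    assume "\<not> r \<le> dist u v"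
    moreover have "v \<in> K" using v(1) \<open>E \<subseteq> A\<close> A_def by blast
    moreover have "openin (top_of_set K) (K \<inter> ball u r)" "K \<inter> ball u r \<subseteq> A"
      by (auto simp: openin_open_Int A_def)
    ultimately have "v \<in> (top_of_set K) interior_of A"
      unfolding interior_of_def by auto
    then show False using v(2) by (simp add: frontier_of_def)
  qed
  ultimately show ?thesis using that v(1) A_def by blast
qed

text \<open>Connectedness yields points of \<open>K\<close> whose distances from \<open>x\<close>
  are successive multiples of \<open>4 * r\<close>, hence points at mutual distance at least
  \<open>4 * r\<close>. Each element of \<open>P\<close> is within \<open>2 * r\<close> of at most
  one of them, and the pigeonhole principle leaves two good ones.\<close>

lemma separated_points_avoiding_finite:
  fixes K :: "'a::metric_space set"
  assumes "connected K" "x \<in> K" "y \<in> K" "4 * r * (real (card P) + 1) \<le> dist x y" "finite P" "0 < r"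
  obtains u v where "u \<in> K" "v \<in> K" "4 * r \<le> dist u v"
    "\<And>p. p \<in> P \<Longrightarrow> 2 * r \<le> dist u p" "\<And>p. p \<in> P \<Longrightarrow> 2 * r \<le> dist v p"
proof -
  \<comment> \<open>These are \<open>card P + 2\<close> indices, of which at most
    \<open>card P\<close> are spoiled by \<open>P\<close>.\<close>
  define J where "J = {..card P + 1}"
  have "\<exists>u\<in>K. dist x u = 4 * r * real j" if "j \<in> J" for j
  proof -
    have "connected (dist x ` K)" using assms(1) by (intro connected_continuous_image continuous_intros)
    moreover have "dist x x \<in> dist x ` K" "dist x y \<in> dist x ` K" using assms by blast+
    moreover have "4 * r * real j \<le> dist x y"
      by (rule order_trans[OF _ assms(4)], rule mult_left_mono) (use that assms(6) in \<open>auto simp: J_def\<close>)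
    ultimately have "4 * r * real j \<in> dist x ` K"
      using assms(4,6) connectedD_interval[of "dist x ` K" "dist x x" "dist x y" "4 * r * real j"] by simp
    then show ?thesis by force
  qed
  then obtain w where w: "\<And>j. j \<in> J \<Longrightarrow> w j \<in> K" "\<And>j. j \<in> J \<Longrightarrow> dist x (w j) = 4 * r * real j" by metis
  have sep: "4 * r \<le> dist (w i) (w j)" if "i \<in> J" "j \<in> J" "i \<noteq> j" for i j
  proof -
    have "1 \<le> \<bar>real i - real j\<bar>" using that by linarith
    then have "4 * r * 1 \<le> 4 * r * \<bar>real i - real j\<bar>" using assms by (intro mult_left_mono) auto
    also have "\<dots> = \<bar>dist x (w i) - dist x (w j)\<bar>"
      using assms w that by (simp add: abs_mult flip: right_diff_distrib)
    also have "\<dots> \<le> dist (w i) (w j)" by (metis abs_dist_diff_le dist_commute)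
    finally show ?thesis by simp
  qed
  define B where "B = {j \<in> J. \<exists>p\<in>P. dist (w j) p < 2 * r}"
  obtain q where q: "\<And>j. j \<in> B \<Longrightarrow> q j \<in> P \<and> dist (w j) (q j) < 2 * r" 
  proof -
    have "\<forall>j\<in>B. \<exists>p. p \<in> P \<and> dist (w j) p < 2 * r" by (auto simp: B_def)
    then show ?thesis using that by (auto dest!: bchoice)
  qed
  have "inj_on q B"
  proof (rule inj_onI, rule ccontr)
    fix i j assume ij: "i \<in> B" "j \<in> B" "q i = q j" "i \<noteq> j"
    have "dist (w i) (w j) \<le> dist (w i) (q i) + dist (w j) (q j)"
      using ij(3) dist_triangle2[of "w i" "w j" "q i"] by simp
    moreover have "4 * r \<le> dist (w i) (w j)" using ij sep by (simp add: B_def)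
    ultimately show False using q[OF ij(1)] q[OF ij(2)] by linarith
  qed
  then have "card B \<le> card P" using q assms(5) by (intro card_inj_on_le[of q]) auto
  moreover have "card (J - B) = card J - card B" by (rule card_Diff_subset) (auto simp: B_def J_def)
  ultimately have "2 \<le> card (J - B)" by (simp add: J_def)
  then obtain i j where "i \<in> J - B" "j \<in> J - B" "i \<noteq> j"
    using card_le_Suc0_iff_eq[of "J - B"] by (auto simp: J_def)
  then show ?thesis using that[of "w i" "w j"] w sep by (auto simp: B_def not_less)
qed


section \<open>Expansive homeomorphisms of a compact set\<close>

locale expansive_homeo =
  fixes X :: "'a::metric_space set" and T S :: "'a \<Rightarrow> 'a" and c :: real
  assumes compact_X: "compact X"
    and homeo: "homeomorphism X X T S"
    and c_pos: "0 < c"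
    and expands: "\<And>x y. x \<in> X \<Longrightarrow> y \<in> X \<Longrightarrow> x \<noteq> y \<Longrightarrow>
      \<exists>n. c < dist ((T ^^ n) x) ((T ^^ n) y) \<or> c < dist ((S ^^ n) x) ((S ^^ n) y)"
begin

text \<open>The assumptions are symmetric in \<open>T\<close> and \<open>S\<close>, so facts about
  forward iterates can be reused for backward ones.\<close>

lemma inverse_system: "expansive_homeo X S T c"
proof
  show "homeomorphism X X S T" using homeo by (rule homeomorphism_symD)
qed (use compact_X c_pos expands in blast)+

lemma funpow_homeo: "homeomorphism X X (T ^^ n) (S ^^ n)"
  using homeomorphism_funpow[OF homeo] .

lemma T_in: "x \<in> X \<Longrightarrow> (T ^^ n) x \<in> X"
  and S_in: "x \<in> X \<Longrightarrow> (S ^^ n) x \<in> X"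
  and S_T: "x \<in> X \<Longrightarrow> (S ^^ n) ((T ^^ n) x) = x"
  and T_S: "x \<in> X \<Longrightarrow> (T ^^ n) ((S ^^ n) x) = x"
  and continuous_T: "continuous_on X (T ^^ n)"
  and continuous_S: "continuous_on X (S ^^ n)"
  using funpow_homeo[of n] unfolding homeomorphism_def by auto

lemma S_T_le: "(S ^^ i) ((T ^^ n) x) = (T ^^ (n - i)) x" if "x \<in> X" "i \<le> n"
proof -
  have "(T ^^ n) x = (T ^^ i) ((T ^^ (n - i)) x)"
    using that by (metis funpow_add comp_apply le_add_diff_inverse)
  then show ?thesis using that by (simp add: S_T T_in)
qed

lemma S_T_ge: "(S ^^ i) ((T ^^ n) x) = (S ^^ (i - n)) x" if "x \<in> X" "n \<le> i"
proof -
  have "(S ^^ i) ((T ^^ n) x) = (S ^^ (i - n)) ((S ^^ n) ((T ^^ n) x))"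
    using that by (metis funpow_add comp_apply le_add_diff_inverse2)
  then show ?thesis using that by (simp add: S_T)
qed

text \<open>The pairs at distance at least \<open>d\<close> form a compact set, covered by the
  relatively open sets of pairs separated at time \<open>n\<close> in one of the two
  directions.\<close>

lemma uniform_expansivity:
  assumes "0 < d"
  obtains N where "\<And>x y. x \<in> X \<Longrightarrow> y \<in> X \<Longrightarrow> d \<le> dist x y \<Longrightarrow>
    \<exists>n\<le>N. c < dist ((T ^^ n) x) ((T ^^ n) y) \<or> c < dist ((S ^^ n) x) ((S ^^ n) y)"
proof -
  define g where "g n z = max (dist ((T ^^ n) (fst z)) ((T ^^ n) (snd z))) (dist ((S ^^ n) (fst z)) ((S ^^ n) (snd z)))"
    for n and z :: "'a \<times> 'a"
  have g: "continuous_on (X \<times> X) (g n)" for n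
    unfolding g_def
    by (intro continuous_intros continuous_on_compose2[OF continuous_T] continuous_on_compose2[OF continuous_S]) auto
  define K where "K = (X \<times> X) \<inter> (\<lambda>z. dist (fst z) (snd z)) -` {d..}"
  have "closedin (top_of_set (X \<times> X)) K"
    unfolding K_def by (intro continuous_closedin_preimage continuous_intros)
  then have "compact K" using closedin_compact compact_Times[OF compact_X compact_X] by blast
  moreover have "openin (top_of_set K) (K \<inter> g n -` {c<..})" for n
    using continuous_on_subset[OF g] by (intro continuous_openin_preimage_gen) (auto simp: K_def)
  moreover have "\<exists>i. z \<in> K \<inter> g i -` {c<..}" if "z \<in> K" for z
    using that expands[of "fst z" "snd z"] assms
    by (cases "fst z = snd z") (auto simp: K_def g_def less_max_iff_disj)
  ultimately have "\<exists>N. \<forall>z\<in>K. \<exists>i\<le>N. z \<in> K \<inter> g i -` {c<..}"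
    by (rule compact_uniform_index)
  then obtain N where N: "\<And>z. z \<in> K \<Longrightarrow> \<exists>i\<le>N. z \<in> K \<inter> g i -` {c<..}" by blast
  have "\<exists>n\<le>N. c < dist ((T ^^ n) x) ((T ^^ n) y) \<or> c < dist ((S ^^ n) x) ((S ^^ n) y)"
    if "x \<in> X" "y \<in> X" "d \<le> dist x y" for x y
    using N[of "(x, y)"] that by (auto simp: K_def g_def less_max_iff_disj)
  then show ?thesis using that by blast
qed

lemma uniform_small_T:
  obtains e where "0 < e" "\<And>x y i. x \<in> X \<Longrightarrow> y \<in> X \<Longrightarrow> dist x y < e \<Longrightarrow> i \<le> N \<Longrightarrow>
    dist ((T ^^ i) x) ((T ^^ i) y) \<le> c"
proof -
  have "\<exists>e>0. \<forall>x\<in>X. \<forall>y\<in>X. dist x y < e \<longrightarrow> dist ((T ^^ i) x) ((T ^^ i) y) < c" for i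
    using compact_uniformly_continuous[OF continuous_T compact_X, of i] c_pos
    unfolding uniformly_continuous_on_def by metis
  then obtain e where e: "\<And>i. 0 < e i"
    "\<And>i x y. x \<in> X \<Longrightarrow> y \<in> X \<Longrightarrow> dist x y < e i \<Longrightarrow> dist ((T ^^ i) x) ((T ^^ i) y) < c"
    by metis
  show ?thesis
  proof
    show "0 < Min (e ` {..N})" using e(1) by auto
    show "dist ((T ^^ i) x) ((T ^^ i) y) \<le> c"
      if "x \<in> X" "y \<in> X" "dist x y < Min (e ` {..N})" "i \<le> N" for x y i
      using e(2)[of x y i] that by (auto intro: less_imp_le)
  qed
qed

end


section \<open>The trap around a finite invariant set and its invariant core\<close>

locale expansive_trap = expansive_homeo X T S c
  for X :: "'a::metric_space set" and T S :: "'a \<Rightarrow> 'a" and c :: real +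
  fixes P :: "'a set" and r :: real and N :: nat
  assumes finite_P: "finite P" and P_ne: "P \<noteq> {}" and P_X: "P \<subseteq> X" and T_P: "T ` P = P"
    and r_pos: "0 < r" and r_small: "4 * r * (real (card P) + 1) \<le> c"
    and separates: "\<And>x y. x \<in> X \<Longrightarrow> y \<in> X \<Longrightarrow> r \<le> dist x y \<Longrightarrow>
      \<exists>n\<le>N. c < dist ((T ^^ n) x) ((T ^^ n) y) \<or> c < dist ((S ^^ n) x) ((S ^^ n) y)"
    and finite_invariant: "\<And>Y. closedin (top_of_set X) Y \<Longrightarrow> Y \<noteq> X \<Longrightarrow> T ` Y = Y \<Longrightarrow> finite Y"
begin

text \<open>
  Removing a neighbourhood of an invariant set costs only \<open>card P\<close> holes however large \<open>N\<close> is. This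
  allows \<open>r\<close> to be fixed before \<open>N\<close>, which depends on \<open>r\<close>.
\<close>

definition W :: "'a set" where
  "W = (\<Union>j\<le>N. (T ^^ j) ` {x \<in> X. \<forall>p\<in>P. r \<le> dist x p})"

lemma compact_W: "compact W"
proof -
  have "{x \<in> X. \<forall>p\<in>P. r \<le> dist x p} = X \<inter> (\<Inter>p\<in>P. {x. r \<le> dist x p})" by auto
  moreover have "closed (\<Inter>p\<in>P. {x. r \<le> dist x p})"
    by (intro closed_INT ballI closed_Collect_le continuous_intros)
  ultimately have "compact {x \<in> X. \<forall>p\<in>P. r \<le> dist x p}"
    using compact_X by (simp add: compact_Int_closed)
  then show ?thesis unfolding W_def
    by (intro compact_UN finite_atMost compact_continuous_image continuous_on_subset[OF continuous_T]) auto
qed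

lemma in_W: "x \<in> X \<Longrightarrow> (\<And>p. p \<in> P \<Longrightarrow> r \<le> dist x p) \<Longrightarrow> i \<le> N \<Longrightarrow> (T ^^ i) x \<in> W"
  unfolding W_def by blast

text \<open>As \<open>P\<close> is invariant and the iterates are injective, a point whose image
  under \<open>T ^^ j\<close> lies in \<open>P\<close> is itself in \<open>P\<close>, so it is not
  at distance \<open>r\<close> from \<open>P\<close>.\<close>

lemma W_disjoint_P: "p \<notin> W" if "p \<in> P"
proof
  assume "p \<in> W"
  then obtain j x where x: "x \<in> X" "\<forall>p\<in>P. r \<le> dist x p" "p = (T ^^ j) x"
    by (auto simp: W_def)
  have "(T ^^ j) ` P = P" using T_P by (rule funpow_image_eq)
  then have "p \<in> (T ^^ j) ` P" using that by simp
  then obtain q where q: "q \<in> P" "p = (T ^^ j) q" by blast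
  then have "q = x" using x S_T P_X by (metis subsetD)
  then show False using x(2) q(1) r_pos by force
qed

definition F :: "'a set" where
  "F = {x \<in> X. \<forall>n. (T ^^ n) x \<in> W \<and> (S ^^ n) x \<in> W}"

lemma T_F: "T ` F = F"
proof -
  have 1: "T x \<in> F" if "x \<in> F" for x
  proof -
    have x: "x \<in> X" and xW: "\<And>n. (T ^^ n) x \<in> W" "\<And>n. (S ^^ n) x \<in> W" using that by (auto simp: F_def)
    have "(T ^^ n) (T x) \<in> W" for n using xW(1)[of "Suc n"] by (simp add: funpow_swap1)
    moreover have "(S ^^ n) (T x) \<in> W" for n
    proof (cases n)
      case 0
      then show ?thesis using xW(1)[of 1] by simp
    next
      case (Suc m)
      then show ?thesis using S_T_ge[OF x, of 1 "Suc m"] xW(2)[of m] by simp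
    qed
    ultimately show ?thesis using T_in[OF x, of 1] by (simp add: F_def)
  qed
  have 2: "S x \<in> F" "T (S x) = x" if "x \<in> F" for x
  proof -
    interpret inv: expansive_homeo X S T c by (rule inverse_system)
    have x: "x \<in> X" and xW: "\<And>n. (T ^^ n) x \<in> W" "\<And>n. (S ^^ n) x \<in> W" using that by (auto simp: F_def)
    have "(S ^^ n) (S x) \<in> W" for n using xW(2)[of "Suc n"] by (simp add: funpow_swap1)
    moreover have "(T ^^ n) (S x) \<in> W" for n
    proof (cases n)
      case 0
      then show ?thesis using xW(2)[of 1] by simp
    next
      case (Suc m)
      then show ?thesis using inv.S_T_ge[OF x, of 1 "Suc m"] xW(1)[of m] by simp
    qed
    ultimately show "S x \<in> F" using S_in[OF x, of 1] by (simp add: F_def)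
    show "T (S x) = x" using T_S[OF x, of 1] by simp
  qed
  show ?thesis using 1 2 by (metis image_eqI image_subsetI subsetI subset_antisym)
qed

text \<open>\<open>F\<close> is a proper subset of \<open>X\<close> because it lies in
  \<open>W\<close>, which misses the nonempty set \<open>P\<close>.\<close>

lemma finite_F: "finite F"
proof (rule finite_invariant)
  have "F = (\<Inter>n. (X \<inter> (T ^^ n) -` W) \<inter> (X \<inter> (S ^^ n) -` W))" by (auto simp: F_def)
  moreover have "closedin (top_of_set X) \<dots>"
    by (intro closedin_INT closedin_Int continuous_closedin_preimage continuous_T continuous_S
        compact_imp_closed compact_W) auto
  ultimately show "closedin (top_of_set X) F" by simp
  obtain p where "p \<in> P" using P_ne by blast
  moreover have "(T ^^ 0) q \<in> W" if "q \<in> F" for q using that unfolding F_def by blast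
  ultimately have "p \<in> X" "p \<notin> F" using P_X W_disjoint_P by auto
  then show "F \<noteq> X" by blast
qed (rule T_F)

text \<open>Every point of the compact set of points at distance at least \<open>e\<close> from
  \<open>F\<close> leaves \<open>W\<close> at some time, forwards or backwards, and compactness
  bounds that time.\<close>

lemma confinement:
  assumes "0 < e"
  obtains n where "\<And>z. z \<in> X \<Longrightarrow> (\<And>j. j \<le> n \<Longrightarrow> (T ^^ j) z \<in> W \<and> (S ^^ j) z \<in> W) \<Longrightarrow> \<exists>p\<in>F. dist z p < e"
proof -
  define K where "K = X \<inter> (\<Inter>p\<in>F. {x. e \<le> dist x p})"
  define U where "U i = (K \<inter> (T ^^ i) -` (-W)) \<union> (K \<inter> (S ^^ i) -` (-W))" for i
  have "closed (\<Inter>p\<in>F. {x. e \<le> dist x p})"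
    by (intro closed_INT ballI closed_Collect_le continuous_intros)
  then have "compact K" using compact_X by (simp add: K_def compact_Int_closed)
  moreover have "openin (top_of_set K) (U i)" for i
    unfolding U_def
    by (intro openin_Un continuous_openin_preimage_gen continuous_on_subset[OF continuous_T]
        continuous_on_subset[OF continuous_S] open_Compl compact_imp_closed compact_W) (auto simp: K_def)
  moreover have "\<exists>i. x \<in> U i" if "x \<in> K" for x
  proof -
    have "x \<notin> F" using that assms by (force simp: K_def)
    then show ?thesis using that by (auto simp: F_def U_def K_def)
  qed
  ultimately have "\<exists>n. \<forall>x\<in>K. \<exists>i\<le>n. x \<in> U i" by (rule compact_uniform_index)
  then obtain n where n: "\<forall>x\<in>K. \<exists>i\<le>n. x \<in> U i" by blast
  show ?thesis
  proof
    fix z assume z: "z \<in> X" "\<And>j. j \<le> n \<Longrightarrow> (T ^^ j) z \<in> W \<and> (S ^^ j) z \<in> W"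
    then have "z \<notin> K" using n by (auto simp: U_def)
    then show "\<exists>p\<in>F. dist z p < e" using z(1) by (auto simp: K_def not_le)
  qed
qed

section \<open>Growth and branching of continua\<close>

text \<open>
  The set \<open>D\<close> is seen at the time at which it has grown large: \<open>h\<close> is the length of the past during
  which it was small, and \<open>a\<close> is the length of the past which it spent in \<open>W\<close>.
\<close>

definition grown :: "nat \<Rightarrow> nat \<Rightarrow> 'a set \<Rightarrow> bool" where
  "grown h a D \<longleftrightarrow> D \<subseteq> X \<and> compact D \<and> connected D \<and> (\<exists>x\<in>D. \<exists>y\<in>D. c < dist x y) \<and>
     (\<forall>x\<in>D. \<forall>y\<in>D. \<forall>i\<in>{1..h}. dist ((S ^^ i) x) ((S ^^ i) y) \<le> c) \<and>
     (\<forall>x\<in>D. \<forall>i\<in>{1..a}. (S ^^ i) x \<in> W)"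

text \<open>\<open>E\<close> is recorded at the time of \<open>D\<close>, before it grows, so that
  two children with different growth times can still be compared inside \<open>D\<close>. Positivity
  of \<open>n\<close> makes the recorded past strictly longer.\<close>

definition child :: "nat \<Rightarrow> nat \<Rightarrow> 'a set \<Rightarrow> 'a set \<Rightarrow> nat \<Rightarrow> bool" where
  "child h a D E n \<longleftrightarrow> E \<subseteq> D \<and> 0 < n \<and> grown (h + n) (a + n) ((T ^^ n) ` E) \<and>
     (\<forall>x\<in>E. \<forall>i\<le>n. (T ^^ i) x \<in> W)"

text \<open>A subcontinuum \<open>E\<close> from \<open>u\<close> to the sphere of radius
  \<open>r\<close> has diameter at most \<open>2 * r\<close>, below \<open>c\<close>;
  \<open>n\<close> is the first time at which its diameter exceeds \<open>c\<close>. Since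
  \<open>E\<close> keeps distance \<open>r\<close> from \<open>P\<close> and
  \<open>n \<le> N\<close>, it stays in \<open>W\<close> until then.\<close>

lemma grown_expand:
  assumes D: "grown h a D" and "N \<le> h" and u: "u \<in> D" "\<And>p. p \<in> P \<Longrightarrow> 2 * r \<le> dist u p"
  shows "\<exists>E n. child h a D E n \<and> E \<subseteq> cball u r"
proof -
  have DX: "D \<subseteq> X" and hist: "\<And>x y i. x \<in> D \<Longrightarrow> y \<in> D \<Longrightarrow> 1 \<le> i \<Longrightarrow> i \<le> h \<Longrightarrow> dist ((S ^^ i) x) ((S ^^ i) y) \<le> c"
    and histW: "\<And>x i. x \<in> D \<Longrightarrow> 1 \<le> i \<Longrightarrow> i \<le> a \<Longrightarrow> (S ^^ i) x \<in> W"
    using D by (auto simp: grown_def)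
  have r4: "4 * r \<le> c"
  proof -
    have "4 * r * 1 \<le> 4 * r * (real (card P) + 1)" using r_pos by (intro mult_left_mono) auto
    then show ?thesis using r_small by linarith
  qed
  obtain x y where xy: "x \<in> D" "y \<in> D" "c < dist x y" using D by (auto simp: grown_def)
  \<comment> \<open>Two points more than \<open>4 * r\<close> apart cannot both lie within
    \<open>r\<close> of \<open>u\<close>.\<close>
  then have "r < dist u x \<or> r < dist u y" using dist_triangle3[of x y u] r4 r_pos by linarith
  then obtain w where "w \<in> D" "r < dist u w" using xy by blast
  then obtain E v where E: "compact E" "connected E" "u \<in> E" "E \<subseteq> D \<inter> cball u r" "v \<in> E" "r \<le> dist u v"
    using subcontinuum_reaching_sphere[of D u w r] D u(1) r_pos unfolding grown_def by metis
  then have EX: "E \<subseteq> X" and ED: "E \<subseteq> D" using DX by auto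
  define Q where "Q n \<longleftrightarrow> (\<exists>x\<in>E. \<exists>y\<in>E. c < dist ((T ^^ n) x) ((T ^^ n) y))" for n
  define n where "n = (LEAST n. Q n)"
  have notQ0: "\<not> Q 0"
  proof
    assume "Q 0"
    then obtain x y where "x \<in> E" "y \<in> E" "c < dist x y" by (auto simp: Q_def)
    moreover from this have "dist u x \<le> r" "dist u y \<le> r" using E(4) by auto
    ultimately show False using dist_triangle3[of x y u] r4 r_pos by linarith
  qed
  \<comment> \<open>Uniform expansivity separates \<open>u\<close> and \<open>v\<close> within time
    \<open>N\<close>. The small past of \<open>D\<close>, known for \<open>h \<ge> N\<close> steps,
    rules out backward separation, and time 0 is excluded by the size of \<open>E\<close>; so the
    separation is forward.\<close>
  have "\<exists>n\<le>N. Q n"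
  proof -
    obtain m where m: "m \<le> N" "c < dist ((T ^^ m) u) ((T ^^ m) v) \<or> c < dist ((S ^^ m) u) ((S ^^ m) v)"
      using separates[of u v] E EX by blast
    have "\<not> c < dist u v" using notQ0 E(3,5) by (auto simp: Q_def)
    then have "m \<noteq> 0" using m by (cases m) auto
    then have "\<not> c < dist ((S ^^ m) u) ((S ^^ m) v)"
      using hist[of u v m] m(1) \<open>N \<le> h\<close> E ED by force
    then have "Q m" using m E by (auto simp: Q_def)
    then show ?thesis using m(1) by blast
  qed
  then obtain m where m: "m \<le> N" "Q m" by blast
  have Qn: "Q n" unfolding n_def using m(2) by (rule LeastI)
  have nN: "n \<le> N" unfolding n_def using m by (meson Least_le order_trans)
  have below: "dist ((T ^^ i) x) ((T ^^ i) y) \<le> c" if "i < n" "x \<in> E" "y \<in> E" for i x y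
  proof -
    have "\<not> Q i" using not_less_Least that(1) unfolding n_def by blast
    then show ?thesis using that by (auto simp: Q_def not_less)
  qed
  have n0: "0 < n" using Qn notQ0 by (cases n) auto
  have EW: "(T ^^ i) x \<in> W" if "x \<in> E" "i \<le> n" for x i
  proof (rule in_W)
    show "r \<le> dist x p" if "p \<in> P" for p
      using u(2)[OF that] E(4) \<open>x \<in> E\<close> dist_triangle[of u p x] by force
  qed (use that EX nN in auto)
  have "grown (h + n) (a + n) ((T ^^ n) ` E)"
    unfolding grown_def
  proof (intro conjI ballI)
    show "(T ^^ n) ` E \<subseteq> X" using EX T_in by blast
    show "compact ((T ^^ n) ` E)" "connected ((T ^^ n) ` E)"
      using E(1,2) EX continuous_on_subset[OF continuous_T]
      by (auto intro: compact_continuous_image connected_continuous_image)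
    show "\<exists>x\<in>(T ^^ n) ` E. \<exists>y\<in>(T ^^ n) ` E. c < dist x y" using Qn by (auto simp: Q_def)
  next
    fix x y i assume xy: "x \<in> (T ^^ n) ` E" "y \<in> (T ^^ n) ` E" "i \<in> {1..h + n}"
    then obtain x' y' where x': "x = (T ^^ n) x'" "x' \<in> E" and y': "y = (T ^^ n) y'" "y' \<in> E" by blast
    show "dist ((S ^^ i) x) ((S ^^ i) y) \<le> c"
    \<comment> \<open>Going back at most \<open>n\<close> steps from the image lands at time
      \<open>n - i < n\<close>, before \<open>E\<close> has grown; going further back lands in the
      past of \<open>D\<close>.\<close>
    proof (cases "i \<le> n")
      case True
      then show ?thesis using below[of "n - i" x' y'] x' y' xy(3) n0 EX by (simp add: S_T_le subset_iff)
    next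
      case False
      then show ?thesis using hist[of x' y' "i - n"] x' y' xy(3) EX ED by (simp add: S_T_ge subset_iff)
    qed
  next
    fix x i assume x: "x \<in> (T ^^ n) ` E" "i \<in> {1..a + n}"
    then obtain x' where x': "x = (T ^^ n) x'" "x' \<in> E" by blast
    show "(S ^^ i) x \<in> W"
    proof (cases "i \<le> n")
      case True
      then show ?thesis using EW[of x' "n - i"] x' EX by (simp add: S_T_le subset_iff)
    next
      case False
      then show ?thesis using histW[of x' "i - n"] x' x(2) EX ED by (simp add: S_T_ge subset_iff)
    qed
  qed
  then have "child h a D E n" using ED n0 EW by (simp add: child_def)
  then show ?thesis using E(4) by blast
qed

text \<open>Diameter above \<open>c\<close> leaves room for two points \<open>4 * r\<close> apart
  and \<open>2 * r\<close> away from \<open>P\<close>. Expanding a continuum within \<open>r\<close>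
  of each one keeps the two children apart.\<close>

lemma grown_branch:
  assumes D: "grown h a D" and "N \<le> h"
  shows "\<exists>E n E' n'. child h a D E n \<and> child h a D E' n' \<and> (\<forall>x\<in>E. \<forall>y\<in>E'. r \<le> dist x y)"
proof -
  obtain x y where xy: "x \<in> D" "y \<in> D" "c < dist x y" using D by (auto simp: grown_def)
  then have "4 * r * (real (card P) + 1) \<le> dist x y" using r_small by linarith
  then obtain u v where uv: "u \<in> D" "v \<in> D" "4 * r \<le> dist u v"
    "\<And>p. p \<in> P \<Longrightarrow> 2 * r \<le> dist u p" "\<And>p. p \<in> P \<Longrightarrow> 2 * r \<le> dist v p"
    using separated_points_avoiding_finite[of D x y r P] xy D finite_P r_pos unfolding grown_def by metis
  obtain E n where E: "child h a D E n" "E \<subseteq> cball u r"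
    using grown_expand[OF assms uv(1,4)] by blast
  obtain E' n' where E': "child h a D E' n'" "E' \<subseteq> cball v r"
    using grown_expand[OF assms uv(2,5)] by blast
  have "r \<le> dist x y" if "x \<in> E" "y \<in> E'" for x y
  proof -
    have "dist u x \<le> r" "dist v y \<le> r" using E(2) E'(2) that by auto
    then show ?thesis
      using uv(3) r_pos dist_triangle[of u v x] dist_triangle2[of x v y] by linarith
  qed
  then show ?thesis using E(1) E'(1) by blast
qed

section \<open>Orbits trapped in \<open>W\<close>, shadowing, and the count of shadowed
  points\<close>

lemma orbit_in_W:
  assumes "\<And>i. i \<le> n \<Longrightarrow> (T ^^ i) x \<in> W" "\<And>j. j \<le> m \<Longrightarrow> (T ^^ j) ((T ^^ n) x) \<in> W" "i \<le> n + m"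
  shows "(T ^^ i) x \<in> W"
proof (cases "i \<le> n")
  case False
  then have "(T ^^ i) x = (T ^^ (i - n)) ((T ^^ n) x)"
    by (metis comp_apply funpow_add le_add_diff_inverse2 nat_le_linear)
  then show ?thesis using assms(2)[of "i - n"] assms(3) by simp
qed (use assms in blast)

text \<open>Following one child repeatedly gives points of \<open>D\<close> that stay in
  \<open>W\<close> for any prescribed finite time. If every point of \<open>D\<close> left
  \<open>W\<close>, compactness would bound the exit times.\<close>

lemma grown_orbit_in_W:
  assumes D: "grown h a D" and h: "N \<le> h"
  shows "\<exists>x\<in>D. \<forall>j. (T ^^ j) x \<in> W"
proof -
  have fin: "grown h a D \<Longrightarrow> N \<le> h \<Longrightarrow> \<exists>x\<in>D. \<forall>j\<le>m. (T ^^ j) x \<in> W" for m h a D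
  proof (induction m arbitrary: h a D)
    case 0
    obtain E n where E: "child h a D E n" using grown_branch[OF 0] by blast
    then obtain x where "x \<in> E" by (auto simp: child_def grown_def)
    then show ?case using E unfolding child_def by blast
  next
    case (Suc m)
    obtain E n where "child h a D E n" using grown_branch[OF Suc.prems] by blast
    then have E: "E \<subseteq> D" "0 < n" "grown (h + n) (a + n) ((T ^^ n) ` E)"
      "\<And>x i. x \<in> E \<Longrightarrow> i \<le> n \<Longrightarrow> (T ^^ i) x \<in> W"
      by (auto simp: child_def)
    obtain x where x: "x \<in> E" "\<And>j. j \<le> m \<Longrightarrow> (T ^^ j) ((T ^^ n) x) \<in> W"
      using Suc.IH[OF E(3)] Suc.prems(2) by auto
    \<comment> \<open>Since \<open>0 < n\<close>, the time \<open>Suc m\<close> is covered by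
      \<open>n + m\<close>.\<close>
    have "(T ^^ j) x \<in> W" if "j \<le> Suc m" for j
      by (rule orbit_in_W[where n = n and m = m]) (use E(2,4) x that in auto)
    then show ?case using x(1) E(1) by blast
  qed
  show ?thesis
  proof (rule ccontr)
    assume neg: "\<not> ?thesis"
    have "compact D" "D \<subseteq> X" using D by (auto simp: grown_def)
    have "openin (top_of_set D) (D \<inter> (T ^^ i) -` (- W))" for i
      using \<open>D \<subseteq> X\<close> by (intro continuous_openin_preimage_gen continuous_on_subset[OF continuous_T]
        open_Compl compact_imp_closed compact_W)
    then have "\<exists>m. \<forall>x\<in>D. \<exists>i\<le>m. x \<in> D \<inter> (T ^^ i) -` (- W)"
      by (rule compact_uniform_index[OF \<open>compact D\<close>]) (use neg in blast)
    then obtain m where "\<forall>x\<in>D. \<exists>i\<le>m. (T ^^ i) x \<notin> W" by blast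
    then show False using fin[OF D h, of m] by blast
  qed
qed

text \<open>The count of points of \<open>F\<close> shadowed by \<open>D\<close> is at least that of
  the grown image of one child plus one for the other child. Induction pushes it past
  \<open>card F\<close>.\<close>

lemma not_grown:
  assumes D0: "grown h0 a0 D0" and h0: "N \<le> h0"
  shows False
proof -
  obtain s where s: "0 < s" "\<And>p q. p \<in> F \<Longrightarrow> q \<in> F \<Longrightarrow> p \<noteq> q \<Longrightarrow> s \<le> dist p q"
  proof
    \<comment> \<open>The element 1 keeps \<open>R\<close> nonempty when \<open>F\<close> has at
      most one point.\<close>
    define R where "R = insert 1 ((\<lambda>(p, q). dist p q) ` (F \<times> F - Id))"
    have "finite R" using finite_F by (simp add: R_def)
    moreover have "\<forall>t\<in>R. 0 < t" by (auto simp: R_def)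
    ultimately show "0 < Min R" by (simp add: R_def)
    show "Min R \<le> dist p q" if "p \<in> F" "q \<in> F" "p \<noteq> q" for p q
      using \<open>finite R\<close> that by (intro Min_le) (auto simp: R_def)
  qed
  obtain e1 where e1: "0 < e1" "\<And>x y. x \<in> X \<Longrightarrow> y \<in> X \<Longrightarrow> dist x y < e1 \<Longrightarrow> dist (T x) (T y) < s / 2"
  proof -
    have "uniformly_continuous_on X T"
      using compact_uniformly_continuous[OF continuous_T[of 1] compact_X] by simp
    then show ?thesis using s(1) that unfolding uniformly_continuous_on_def by (metis half_gt_zero)
  qed
  \<comment> \<open>The bound \<open>e1\<close> controls one application of \<open>T\<close>,
    \<open>s / 2\<close> makes the nearby point of \<open>F\<close> unique, and \<open>c / 2\<close>
    keeps two points shadowing the same orbit within \<open>c\<close>.\<close>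
  define e where "e = min e1 (min (s / 2) (c / 2))"
  have e: "0 < e" "e \<le> e1" "e \<le> s / 2" "e \<le> c / 2" using e1 s(1) c_pos by (auto simp: e_def)
  obtain n0 where n0: "\<And>z. z \<in> X \<Longrightarrow> (\<And>j. j \<le> n0 \<Longrightarrow> (T ^^ j) z \<in> W \<and> (S ^^ j) z \<in> W) \<Longrightarrow> \<exists>p\<in>F. dist z p < e"
    using confinement[OF e(1)] by metis
  have FX: "F \<subseteq> X" by (auto simp: F_def)
  have same: "p = q" if "p \<in> F" "q \<in> F" "dist x p < s / 2" "dist x q < s / 2" for p q x
    using s(2)[OF that(1,2)] that(3,4) dist_triangle3[of p q x] by linarith
  \<comment> \<open>At each step \<open>confinement\<close> provides some point of \<open>F\<close>
    within \<open>e\<close>, while continuity keeps the image of the old one within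
    \<open>s / 2\<close>; by separation of \<open>F\<close> the two coincide.\<close>
  have shadow: "dist ((T ^^ j) z) ((T ^^ j) p) < e \<and> (T ^^ j) p \<in> F"
    if z: "z \<in> X" "\<And>j. (T ^^ j) z \<in> W" "\<And>i. i \<le> n0 \<Longrightarrow> (S ^^ i) z \<in> W" and p: "p \<in> F" "dist z p < e"
    for z p j
  proof (induction j)
    case 0
    then show ?case using p by simp
  next
    case (Suc j)
    have TF: "(T ^^ Suc j) p \<in> F" using Suc T_F by auto
    have "\<exists>q\<in>F. dist ((T ^^ Suc j) z) q < e"
    proof (rule n0)
      show "(T ^^ Suc j) z \<in> X" using T_in[OF z(1)] by blast
      fix i assume i: "i \<le> n0"
      have "(T ^^ i) ((T ^^ Suc j) z) = (T ^^ (i + Suc j)) z"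
        by (simp only: funpow_add comp_apply)
      moreover have "(S ^^ i) ((T ^^ Suc j) z) \<in> W"
      proof (cases "i \<le> Suc j")
        case True
        then show ?thesis using S_T_le[OF z(1) True] z(2) by presburger
      next
        case False
        then show ?thesis using S_T_ge[OF z(1), of "Suc j" i] z(3)[of "i - Suc j"] i by simp
      qed
      ultimately show "(T ^^ i) ((T ^^ Suc j) z) \<in> W \<and> (S ^^ i) ((T ^^ Suc j) z) \<in> W"
        using z(2) by presburger
    qed
    then obtain q where q: "q \<in> F" "dist ((T ^^ Suc j) z) q < e" by blast
    have "dist ((T ^^ j) z) ((T ^^ j) p) < e1" using Suc e(2) by linarith
    then have close: "dist ((T ^^ Suc j) z) ((T ^^ Suc j) p) < s / 2"
      using e1(2)[OF T_in[OF z(1)] T_in[of p]] p(1) FX by auto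
    have "q = (T ^^ Suc j) p" by (rule same[OF q(1) TF _ close]) (use q(2) e(3) in linarith)
    then show ?case using q TF by blast
  qed
  define near where "near D = {p \<in> F. \<exists>z\<in>D. (\<forall>j. (T ^^ j) z \<in> W) \<and> dist z p < e}" for D
  have fin_near: "finite (near D)" for D using finite_F by (simp add: near_def)
  \<comment> \<open>Passing to children lengthens the past spent in \<open>W\<close>, so it
    eventually reaches the \<open>n0\<close> steps that \<open>confinement\<close> asks for.\<close>
  have "\<exists>h a D. grown h a D \<and> N \<le> h \<and> k \<le> a" for k
  proof (induction k)
    case 0
    then show ?case using D0 h0 by blast
  next
    case (Suc k)
    then obtain h a D where D: "grown h a D" "N \<le> h" "k \<le> a" by blast
    obtain E n where "0 < n" "grown (h + n) (a + n) ((T ^^ n) ` E)"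
      using grown_branch[OF D(1,2)] unfolding child_def by blast
    moreover have "N \<le> h + n" "Suc k \<le> a + n" using D \<open>0 < n\<close> by linarith+
    ultimately show ?case by blast
  qed
  then obtain h a D where D: "grown h a D" "N \<le> h" "n0 \<le> a" by blast
  have "grown h a D \<Longrightarrow> N \<le> h \<Longrightarrow> n0 \<le> a \<Longrightarrow> k \<le> card (near D)" for k h a D
  proof (induction k arbitrary: h a D)
    case 0
    then show ?case by simp
  next
    case (Suc k)
    obtain E n E' n' where "child h a D E n" "child h a D E' n'" "\<forall>x\<in>E. \<forall>y\<in>E'. r \<le> dist x y"
      using grown_branch[OF Suc.prems(1,2)] by blast
    then have E: "E \<subseteq> D" "E' \<subseteq> D" "0 < n" "0 < n'"
      "grown (h + n) (a + n) ((T ^^ n) ` E)" "grown (h + n') (a + n') ((T ^^ n') ` E')"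
      "\<And>x i. x \<in> E \<Longrightarrow> i \<le> n \<Longrightarrow> (T ^^ i) x \<in> W" "\<And>x i. x \<in> E' \<Longrightarrow> i \<le> n' \<Longrightarrow> (T ^^ i) x \<in> W"
      "\<And>x y. x \<in> E \<Longrightarrow> y \<in> E' \<Longrightarrow> r \<le> dist x y"
      by (auto simp: child_def)
    have DX: "D \<subseteq> X"
      and hist: "\<And>x y i. x \<in> D \<Longrightarrow> y \<in> D \<Longrightarrow> 1 \<le> i \<Longrightarrow> i \<le> h \<Longrightarrow> dist ((S ^^ i) x) ((S ^^ i) y) \<le> c"
      and histW: "\<And>x i. x \<in> D \<Longrightarrow> 1 \<le> i \<Longrightarrow> i \<le> a \<Longrightarrow> (S ^^ i) x \<in> W"
      using Suc.prems(1) by (auto simp: grown_def)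
    have past: "(S ^^ i) x \<in> W" if "x \<in> D" "\<And>j. (T ^^ j) x \<in> W" "i \<le> n0" for x i
      using histW[of x i] that(1,3) that(2)[of 0] Suc.prems(3) by (cases i) auto
    have has_near: "\<exists>p\<in>F. dist x p < e" if "x \<in> D" "\<And>j. (T ^^ j) x \<in> W" for x
      using n0[of x] past that DX by blast
    \<comment> \<open>Points of the two branches shadowing the same \<open>p\<close> stay within
      \<open>2 * e \<le> c\<close> at all forward times, and within \<open>c\<close> for
      \<open>N\<close> backward steps by the past of \<open>D\<close>. Being \<open>r\<close> apart,
      they would contradict uniform expansivity.\<close>
    have "near E \<inter> near E' = {}"
    proof (rule ccontr)
      assume "\<not> ?thesis"
      then obtain p z w where p: "p \<in> F" and z: "z \<in> E" "\<And>j. (T ^^ j) z \<in> W" "dist z p < e"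
        and w: "w \<in> E'" "\<And>j. (T ^^ j) w \<in> W" "dist w p < e" by (auto simp: near_def)
      have zw: "z \<in> D" "w \<in> D" using z w E by auto
      have close: "dist ((T ^^ j) z) ((T ^^ j) w) \<le> c" for j
        using shadow[OF _ z(2) past[OF zw(1) z(2)] p z(3), of j] shadow[OF _ w(2) past[OF zw(2) w(2)] p w(3), of j]
          zw DX e(4) dist_triangle2[of "(T ^^ j) z" "(T ^^ j) w" "(T ^^ j) p"] by (auto simp: subset_iff)
      have "dist ((S ^^ j) z) ((S ^^ j) w) \<le> c" if "j \<le> N" for j
        using hist[OF zw, of j] close[of 0] that Suc.prems(2) by (cases j) auto
      then show False using separates[of z w] E(9)[OF z(1) w(1)] close zw DX by (meson not_le subsetD)
    qed
    moreover have "near E \<union> near E' \<subseteq> near D" using E(1,2) by (auto simp: near_def)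
    ultimately have "card (near E) + card (near E') \<le> card (near D)"
      by (metis card_Un_disjoint card_mono fin_near)
    moreover have "near E' \<noteq> {}"
    proof -
      obtain x where x: "x \<in> E'" "\<And>j. (T ^^ j) ((T ^^ n') x) \<in> W"
        using grown_orbit_in_W[OF E(6)] Suc.prems(2) by auto
      have "(T ^^ j) x \<in> W" for j
        by (rule orbit_in_W[of n' x j, OF E(8)[OF x(1)] x(2)]) auto
      then show ?thesis using has_near[of x] x(1) E(2) by (auto simp: near_def)
    qed
    then have "0 < card (near E')" using fin_near by (simp add: card_gt_0_iff)
    \<comment> \<open>A point of \<open>F\<close> near the grown image is the \<open>n\<close>-th
      iterate of one near \<open>E\<close>, so the bound obtained by induction for the image passes
      back to \<open>E\<close>.\<close>
    moreover have "near ((T ^^ n) ` E) \<subseteq> (T ^^ n) ` near E"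
    proof
      fix q assume "q \<in> near ((T ^^ n) ` E)"
      then obtain x where q: "q \<in> F" and x: "x \<in> E" "\<And>j. (T ^^ j) ((T ^^ n) x) \<in> W" "dist ((T ^^ n) x) q < e"
        by (auto simp: near_def)
      have xW: "(T ^^ j) x \<in> W" for j
        by (rule orbit_in_W[of n x j, OF E(7)[OF x(1)] x(2)]) auto
      have xD: "x \<in> D" using x(1) E(1) by blast
      obtain p where p: "p \<in> F" "dist x p < e" using has_near[OF xD xW] by blast
      have "dist ((T ^^ n) x) ((T ^^ n) p) < e" "(T ^^ n) p \<in> F"
        using shadow[OF _ xW past[OF xD xW] p, of n] xD DX by blast+
      then have "q = (T ^^ n) p" using same[OF q, of "(T ^^ n) p" "(T ^^ n) x"] x(3) e(3) by simp
      moreover have "p \<in> near E" using p x(1) xW by (auto simp: near_def)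
      ultimately show "q \<in> (T ^^ n) ` near E" by blast
    qed
    then have "card (near ((T ^^ n) ` E)) \<le> card (near E)"
      using fin_near by (meson card_image_le card_mono finite_imageI order_trans)
    moreover have "k \<le> card (near ((T ^^ n) ` E))"
      using Suc.IH[OF E(5)] Suc.prems by simp
    ultimately show ?case by linarith
  qed
  from this[OF D, of "Suc (card F)"] have "Suc (card F) \<le> card (near D)" .
  also have "\<dots> \<le> card F" using finite_F by (intro card_mono) (auto simp: near_def)
  finally show False by simp
qed

text \<open>At the first time \<open>k\<close> of diameter above \<open>c\<close>, the image would
  be grown with a small past of \<open>k \<ge> N\<close> steps and an empty recorded past in
  \<open>W\<close>, which \<open>not_grown\<close> excludes.\<close>

lemma small_continuum_stays_small:
  assumes A: "A \<subseteq> X" "compact A" "connected A"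
    and small: "\<And>x y i. x \<in> A \<Longrightarrow> y \<in> A \<Longrightarrow> i \<le> N \<Longrightarrow> dist ((T ^^ i) x) ((T ^^ i) y) \<le> c"
    and xy: "x \<in> A" "y \<in> A"
  shows "dist ((T ^^ n) x) ((T ^^ n) y) \<le> c"
proof (rule ccontr)
  assume neg: "\<not> ?thesis"
  define Q where "Q n \<longleftrightarrow> (\<exists>x\<in>A. \<exists>y\<in>A. c < dist ((T ^^ n) x) ((T ^^ n) y))" for n
  define k where "k = (LEAST n. Q n)"
  have "Q n" using neg xy unfolding Q_def by (meson not_le)
  then have Qk: "Q k" unfolding k_def by (rule LeastI)
  then have "N \<le> k" using small unfolding Q_def by (meson nat_le_linear not_le)
  have below: "dist ((T ^^ i) x) ((T ^^ i) y) \<le> c" if "i < k" "x \<in> A" "y \<in> A" for i x y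
  proof -
    have "\<not> Q i" using not_less_Least that(1) unfolding k_def by blast
    then show ?thesis using that by (auto simp: Q_def not_less)
  qed
  have "grown k 0 ((T ^^ k) ` A)"
    unfolding grown_def
  proof (intro conjI ballI)
    show "(T ^^ k) ` A \<subseteq> X" using A T_in by blast
    show "compact ((T ^^ k) ` A)" "connected ((T ^^ k) ` A)"
      using A continuous_on_subset[OF continuous_T]
      by (auto intro: compact_continuous_image connected_continuous_image)
    show "\<exists>x\<in>(T ^^ k) ` A. \<exists>y\<in>(T ^^ k) ` A. c < dist x y" using Qk by (auto simp: Q_def)
  next
    fix x y i assume xy: "x \<in> (T ^^ k) ` A" "y \<in> (T ^^ k) ` A" "i \<in> {1..k}"
    then obtain x' y' where x': "x = (T ^^ k) x'" "x' \<in> A" and y': "y = (T ^^ k) y'" "y' \<in> A" by blast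
    then show "dist ((S ^^ i) x) ((S ^^ i) y) \<le> c"
      using below[of "k - i" x' y'] xy(3) A by (simp add: S_T_le subset_iff)
  qed simp
  then show False using not_grown \<open>N \<le> k\<close> by blast
qed

end


section \<open>Integer iterates, small continua and the conclusion\<close>

lemma zit_of_nat: "zit X T (int n) = T ^^ n"
  by (simp add: zit_def)

lemma zit_minus_of_nat:
  assumes "homeomorphism X X T S" "x \<in> X"
  shows "zit X T (- int n) x = (S ^^ n) x"
proof -
  have inv: "inv_into X T y = S y" if "y \<in> X" for y
    using assms(1) that
    by (intro inv_into_f_eq) (auto simp: homeomorphism_def intro: inj_on_inverseI[of _ S])
  have "(inv_into X T ^^ n) x = (S ^^ n) x \<and> (S ^^ n) x \<in> X"
    using assms inv by (induction n) (auto simp: homeomorphism_def)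
  then show ?thesis by (cases "n = 0") (simp_all add: zit_def)
qed

text \<open>A finite \<open>X\<close> has finitely many self-maps, so two iterates agree on
  \<open>X\<close>; cancelling the smaller one gives a positive power that is the identity.\<close>

lemma faithful_imp_infinite:
  assumes hom: "homeomorphism X X T S" and "faithful X T"
  shows "infinite X"
proof
  assume "finite X"
  have hom_n: "homeomorphism X X (T ^^ n) (S ^^ n)" for n using homeomorphism_funpow[OF hom] .
  have "range (\<lambda>n. restrict (T ^^ n) X) \<subseteq> X \<rightarrow>\<^sub>E X"
    using hom_n by (fastforce simp: homeomorphism_def)
  then have "finite (range (\<lambda>n. restrict (T ^^ n) X))"
    using finite_PiE[OF \<open>finite X\<close>, of "\<lambda>_. X"] \<open>finite X\<close> finite_subset by blast
  then have "\<not> inj (\<lambda>n. restrict (T ^^ n) X)" using finite_imageD infinite_UNIV_nat by blast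
  then obtain i j where "i \<noteq> j" "restrict (T ^^ i) X = restrict (T ^^ j) X" by (auto simp: inj_def)
  then obtain i j where ij: "i < j" "restrict (T ^^ i) X = restrict (T ^^ j) X"
    by (metis linorder_neqE_nat)
  have "(T ^^ (j - i)) x = x" if "x \<in> X" for x
  proof -
    have "(T ^^ i) ((T ^^ (j - i)) x) = (T ^^ j) x"
      using ij(1) by (metis comp_apply funpow_add le_add_diff_inverse less_imp_le)
    also have "\<dots> = (T ^^ i) x" using ij(2) that by (metis restrict_apply')
    finally show ?thesis using hom_n[of i] hom_n[of "j - i"] that unfolding homeomorphism_def by (metis imageI)
  qed
  then have "\<forall>x\<in>X. zit X T (int (j - i)) x = x" unfolding zit_of_nat by blast
  then have "int (j - i) = 0" using assms(2) unfolding faithful_def by blast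
  then show False using ij(1) by simp
qed

text \<open>The closure of a connected neighbourhood of an accumulation point, taken inside a ball
  of radius \<open>e / 3\<close>, has diameter at most two thirds of \<open>e\<close> and contains a
  second point.\<close>

lemma small_nondegenerate_continuum:
  fixes X :: "'a::metric_space set"
  assumes "compact X" "locally connected X" "infinite X" "0 < e"
  obtains A x y where "A \<subseteq> X" "compact A" "connected A" "x \<in> A" "y \<in> A" "x \<noteq> y"
    "\<And>u v. u \<in> A \<Longrightarrow> v \<in> A \<Longrightarrow> dist u v < e"
proof -
  obtain x where x: "x \<in> X" "x islimpt X"
    using assms(1,3) compact_eq_Bolzano_Weierstrass by blast
  have "openin (top_of_set X) (X \<inter> ball x (e / 3))" "x \<in> X \<inter> ball x (e / 3)"
    using x assms(4) by (auto simp: openin_open_Int)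
  then obtain V where V: "openin (top_of_set X) V" "connected V" "x \<in> V" "V \<subseteq> X \<inter> ball x (e / 3)"
    using assms(2) unfolding locally_connected by blast
  then obtain O' where "open O'" "V = X \<inter> O'" by (auto simp: openin_open)
  then obtain y where y: "y \<in> V" "y \<noteq> x" using x(2) V(3) unfolding islimpt_def by blast
  have clX: "closure V \<subseteq> X" using V(4) assms(1) by (simp add: closure_minimal compact_imp_closed)
  have "closure V \<subseteq> cball x (e / 3)"
    using V(4) by (intro closure_minimal) auto
  then have near: "dist x u \<le> e / 3" if "u \<in> closure V" for u using that by auto
  have "dist u v < e" if "u \<in> closure V" "v \<in> closure V" for u v
    using near[OF that(1)] near[OF that(2)] dist_triangle3[of u v x] assms(4) by linarith
  moreover have "compact (closure V)"
    using clX assms(1) compact_Int_closed[of X "closure V"] by (simp add: Int_absorb1)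
  ultimately show ?thesis
    using that[of "closure V" x y] clX V(2,3) y closure_subset[of V] connected_imp_connected_closure by blast
qed

theorem theorem2p11:
  fixes X :: "'a::metric_space set" and T S :: "'a \<Rightarrow> 'a"
  assumes "compact X"
    and "locally connected X"
    and "homeomorphism X X T S"
  shows "\<not> (expansive X T \<and> CAM X T)"
proof
  assume *: "expansive X T \<and> CAM X T"
  then obtain c where c: "0 < c" "\<And>x y. x \<in> X \<Longrightarrow> y \<in> X \<Longrightarrow> x \<noteq> y \<Longrightarrow> \<exists>n. c < dist (zit X T n x) (zit X T n y)"
    unfolding expansive_def by metis
  interpret expansive_homeo X T S c
  proof
    fix x y assume xy: "x \<in> X" "y \<in> X" "x \<noteq> y"
    then obtain n where n: "c < dist (zit X T n x) (zit X T n y)" using c(2) by blast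
    show "\<exists>n. c < dist ((T ^^ n) x) ((T ^^ n) y) \<or> c < dist ((S ^^ n) x) ((S ^^ n) y)"
    proof (cases n rule: int_cases2)
      case (nonneg m)
      then show ?thesis using n zit_of_nat[of X T m] by auto
    next
      case (nonpos m)
      then show ?thesis using n xy zit_minus_of_nat[OF assms(3)] by auto
    qed
  qed (use assms c in auto)
  interpret inv: expansive_homeo X S T c by (rule inverse_system)
  have inf: "infinite X" using faithful_imp_infinite[OF assms(3)] * by (simp add: CAM_def)
  \<comment> \<open>Density of the periodic points in the nonempty \<open>X\<close> yields one of
    them.\<close>
  have "{x. periodic_point X T x} \<noteq> {}"
  proof
    assume "{x. periodic_point X T x} = {}"
    then have "X \<subseteq> closure {}" using * unfolding CAM_def by metis
    then show False using inf by simp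
  qed
  then obtain p where p: "p \<in> X" "finite (range (\<lambda>n. zit X T n p))" by (auto simp: periodic_point_def)
  define P where "P = range (\<lambda>n. (T ^^ n) p)"
  have "P \<subseteq> range (\<lambda>n. zit X T n p)" unfolding P_def by (metis image_subsetI rangeI zit_of_nat)
  then have finP: "finite P" using p(2) finite_subset by blast
  have PX: "P \<subseteq> X" using T_in[OF p(1)] by (auto simp: P_def)
  have "T ((T ^^ n) p) \<in> P" for n unfolding P_def by (metis comp_apply funpow.simps(2) rangeI)
  then have "T ` P \<subseteq> P" by (auto simp: P_def)
  moreover have inj: "inj_on T X" using assms(3) unfolding homeomorphism_def by (metis inj_on_inverseI)
  \<comment> \<open>The forward orbit is mapped into itself, and an injective self-map of a finite
    set is onto.\<close>
  ultimately have TP: "T ` P = P" using endo_inj_surj[OF finP] inj_on_subset[OF inj PX] by blast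
  have STY: "S ` (T ` Y) = Y" "T ` (S ` Y) = Y" if "Y \<subseteq> X" for Y
    using S_T[of _ 1] T_S[of _ 1] that by (force simp: image_image subset_iff)+
  have SP: "S ` P = P" using STY(1)[OF PX] TP by simp
  \<comment> \<open>The largest value allowed by \<open>r_small\<close>.\<close>
  define r where "r = c / (4 * (real (card P) + 1))"
  have r: "0 < r" "4 * r * (real (card P) + 1) \<le> c" using c(1) by (auto simp: r_def field_simps)
  obtain N where N: "\<And>x y. x \<in> X \<Longrightarrow> y \<in> X \<Longrightarrow> r \<le> dist x y \<Longrightarrow>
      \<exists>n\<le>N. c < dist ((T ^^ n) x) ((T ^^ n) y) \<or> c < dist ((S ^^ n) x) ((S ^^ n) y)"
    using uniform_expansivity[OF r(1)] by blast
  have fin_inv: "finite Y" if "closedin (top_of_set X) Y" "Y \<noteq> X" "T ` Y = Y" for Y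
    using * that unfolding CAM_def by blast
  interpret fwd: expansive_trap X T S c P r N
    by unfold_locales (use finP PX TP r N fin_inv in \<open>auto simp: P_def\<close>)
  \<comment> \<open>The same \<open>P\<close>, \<open>r\<close> and \<open>N\<close> serve the
    inverse, since \<open>N\<close> treats both directions alike and sets invariant under
    \<open>S\<close> are invariant under \<open>T\<close>.\<close>
  interpret bwd: expansive_trap X S T c P r N
  proof
    show "\<exists>n\<le>N. c < dist ((S ^^ n) x) ((S ^^ n) y) \<or> c < dist ((T ^^ n) x) ((T ^^ n) y)"
      if "x \<in> X" "y \<in> X" "r \<le> dist x y" for x y using N[OF that] by blast
    show "finite Y" if "closedin (top_of_set X) Y" "Y \<noteq> X" "S ` Y = Y" for Y
    proof (rule fin_inv)
      show "T ` Y = Y" using STY(2)[of Y] that closedin_imp_subset by fastforce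
    qed (use that in auto)
  qed (use finP PX SP r in \<open>auto simp: P_def\<close>)
  obtain e where e: "0 < e" "\<And>x y i. x \<in> X \<Longrightarrow> y \<in> X \<Longrightarrow> dist x y < e \<Longrightarrow> i \<le> N \<Longrightarrow> dist ((T ^^ i) x) ((T ^^ i) y) \<le> c"
    using uniform_small_T by blast
  obtain e' where e': "0 < e'" "\<And>x y i. x \<in> X \<Longrightarrow> y \<in> X \<Longrightarrow> dist x y < e' \<Longrightarrow> i \<le> N \<Longrightarrow> dist ((S ^^ i) x) ((S ^^ i) y) \<le> c"
    using inv.uniform_small_T by blast
  \<comment> \<open>One continuum small for both directions never exceeds diameter \<open>c\<close>
    forwards or backwards, so its two distinct points violate expansivity.\<close>
  have "0 < min e e'" using e(1) e'(1) by simp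
  then obtain A x y where A: "A \<subseteq> X" "compact A" "connected A" and xy: "x \<in> A" "y \<in> A" "x \<noteq> y"
    and small: "\<And>u v. u \<in> A \<Longrightarrow> v \<in> A \<Longrightarrow> dist u v < min e e'"
    using small_nondegenerate_continuum[OF assms(1,2) inf] by blast
  have "dist ((T ^^ n) x) ((T ^^ n) y) \<le> c" for n
    by (rule fwd.small_continuum_stays_small[OF A _ xy(1,2)]) (use e(2) small A(1) in \<open>auto simp: subset_iff\<close>)
  moreover have "dist ((S ^^ n) x) ((S ^^ n) y) \<le> c" for n
    by (rule bwd.small_continuum_stays_small[OF A _ xy(1,2)]) (use e'(2) small A(1) in \<open>auto simp: subset_iff\<close>)
  ultimately show False using expands[of x y] xy A(1) by (meson not_le subsetD)
qed

end
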